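(* Let $\mu>0$, $\gamma>0$, let $q$ be the winning-probability function of the competition, and let $k:[0,\infty)\to[0,\infty)$ be bounded and non-decreasing. Let $b^\star(\tau)=\max\left(0,\ k(\tau)+V^\star(0)-V^\star(\tau)\right)$ be the optimal bid in the repeated second-price auction with dynamic value. If $k$ is concave, then $b^\star$ is increasing (i.e. non-decreasing) in $\tau$ on $[0,\infty)$, and it is strictly increasing on any interval on which $k$ is strictly increasing.
   Context: Setting. Auctions arrive according to a Poisson process of intensity $\mu>0$. At the $i$-th auction the highest competing price is $C_i\ge 0$; the $C_i$ are i.i.d. and independent of the arrivals, and $q(b)=\Pr(C_i<b)$ is the probability of winning with bid $b$ (so $q(b)=0$ for $b\le 0$). The age $\tau$ is the time elapsed since the last won auction: it grows at unit rate and is reset to $0$ after each win. An item won at age $\tau$ has value $k(\tau)$ for the bidder. A bidding policy is a measurable function $b:[0,\infty)\to[0,\infty)$, where $b(\tau)$ is the bid submitted when the age is $\tau$; $\mathcal{B}$ is the set of such policies. An auction is won iff the bid is $>C_i$, and the winner pays $C_i$ (second price). With discount rate $\gamma>0$, current age $\tau$, next auctions occurring at times $T_1<T_2<\dots$ (measured from now), and $\tau(T_i)$ the age just before the auction at time $T_i$ under policy $b$, set $$V_b(\tau)=\mathbb{E}\sum_{i\ge1}e^{-\gamma T_i}\left(k(\tau(T_i))-C_i\right)\mathbf{1}\{b(\tau(T_i))>C_i\},\qquad V^\star(\tau)=\sup_{b\in\mathcal{B}}V_b(\tau).$$ *)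

theory Defs
  imports "HOL-Probability.Probability"
begin

text \<open>Auctions are indexed from 0, so index \<open>i\<close> here is the \<open>(i+1)\<close>-st auction.\<close>

definition gap :: "(nat \<Rightarrow> 'w \<Rightarrow> real) \<Rightarrow> nat \<Rightarrow> 'w \<Rightarrow> real" where
  "gap T i w = (case i of 0 \<Rightarrow> T 0 w | Suc j \<Rightarrow> T (Suc j) w - T j w)"

text \<open>A Poisson process of intensity \<open>\<mu>\<close>, given by its successive arrival times: the
  interarrival times are independent and exponentially distributed with rate \<open>\<mu>\<close>.\<close>

locale poisson_arrivals = prob_space M for M :: "'w measure" +
  fixes \<mu> :: real and T :: "nat \<Rightarrow> 'w \<Rightarrow> real"
  assumes intensity_pos: "0 < \<mu>"
    and first_arrival_pos: "\<And>w. w \<in> space M \<Longrightarrow> 0 < T 0 w"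
    and arrivals_increasing: "\<And>i w. w \<in> space M \<Longrightarrow> T i w < T (Suc i) w"
    and gaps_indep: "indep_vars (\<lambda>_. borel) (gap T) UNIV"
    and gaps_exponential: "\<And>i. distributed M lborel (gap T i) (exponential_density \<mu>)"

text \<open>Assumption \<open>win_prob\<close> says both that the prices are identically distributed and that
  \<open>q\<close> is their common winning-probability function.\<close>

locale auctions = poisson_arrivals M \<mu> T
  for M :: "'w measure" and \<mu> :: real and T :: "nat \<Rightarrow> 'w \<Rightarrow> real" +
  fixes C :: "nat \<Rightarrow> 'w \<Rightarrow> real" and q :: "real \<Rightarrow> real"
  assumes price_nonneg: "\<And>i w. w \<in> space M \<Longrightarrow> 0 \<le> C i w"
    and prices_indep: "indep_vars (\<lambda>_. borel) C UNIV"
    and win_prob: "\<And>i b. prob {w \<in> space M. C i w < b} = q b"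
    and prices_indep_arrivals:
      "indep_var (\<Pi>\<^sub>M i\<in>(UNIV :: nat set). (borel :: real measure)) (\<lambda>w i. T i w)
                 (\<Pi>\<^sub>M i\<in>(UNIV :: nat set). (borel :: real measure)) (\<lambda>w i. C i w)"

text \<open>Only the values of a policy on \<open>[0,\<infinity>)\<close> matter.\<close>

definition policies :: "(real \<Rightarrow> real) set" where
  "policies = {b \<in> borel_measurable (restrict_space borel {0..}). \<forall>x\<ge>0. 0 \<le> b x}"

text \<open>\<open>age b \<tau> t c i\<close> is the age just before auction \<open>i\<close>, for initial age \<open>\<tau>\<close>, arrival
  times \<open>t\<close> and competing prices \<open>c\<close>.\<close>

primrec age :: "(real \<Rightarrow> real) \<Rightarrow> real \<Rightarrow> (nat \<Rightarrow> real) \<Rightarrow> (nat \<Rightarrow> real) \<Rightarrow> nat \<Rightarrow> real" where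
  "age b \<tau> t c 0 = \<tau> + t 0"
| "age b \<tau> t c (Suc i) =
     (if b (age b \<tau> t c i) > c i then 0 else age b \<tau> t c i) + (t (Suc i) - t i)"

definition discounted_gain ::
  "real \<Rightarrow> (real \<Rightarrow> real) \<Rightarrow> (real \<Rightarrow> real) \<Rightarrow> real \<Rightarrow> (nat \<Rightarrow> real) \<Rightarrow> (nat \<Rightarrow> real) \<Rightarrow> nat \<Rightarrow> real"
where
  "discounted_gain \<gamma> k b \<tau> t c i =
     exp (- \<gamma> * t i) * (k (age b \<tau> t c i) - c i) * of_bool (b (age b \<tau> t c i) > c i)"

text \<open>The expectation of the sum of gains is taken as the expected sum of the positive parts
  minus the expected sum of the negative parts (\<open>ennreal\<close> maps negative reals to 0). For bounded
  \<open>k\<close> the former is finite, so the value is well defined in \<open>[-\<infinity>,\<infinity>)\<close>; it is \<open>-\<infinity>\<close> when the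
  expected payments are infinite, which a Bochner integral would turn into 0.\<close>

definition policy_value ::
  "'w measure \<Rightarrow> (nat \<Rightarrow> 'w \<Rightarrow> real) \<Rightarrow> (nat \<Rightarrow> 'w \<Rightarrow> real) \<Rightarrow> real \<Rightarrow> (real \<Rightarrow> real) \<Rightarrow>
   (real \<Rightarrow> real) \<Rightarrow> real \<Rightarrow> ereal"
where
  "policy_value M T C \<gamma> k b \<tau> =
     enn2ereal (\<integral>\<^sup>+w. (\<Sum>i. ennreal (discounted_gain \<gamma> k b \<tau> (\<lambda>j. T j w) (\<lambda>j. C j w) i)) \<partial>M)
   - enn2ereal (\<integral>\<^sup>+w. (\<Sum>i. ennreal (- discounted_gain \<gamma> k b \<tau> (\<lambda>j. T j w) (\<lambda>j. C j w) i)) \<partial>M)"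

text \<open>The supremum is finite: it is at least 0 (always bid 0) and at most
  \<open>\<mu> / \<gamma>\<close> times the supremum of \<open>k\<close>. So \<open>real_of_ereal\<close> loses nothing.\<close>

definition optimal_value ::
  "'w measure \<Rightarrow> (nat \<Rightarrow> 'w \<Rightarrow> real) \<Rightarrow> (nat \<Rightarrow> 'w \<Rightarrow> real) \<Rightarrow> real \<Rightarrow> (real \<Rightarrow> real) \<Rightarrow> real \<Rightarrow> real"
where
  "optimal_value M T C \<gamma> k \<tau> = real_of_ereal (SUP b\<in>policies. policy_value M T C \<gamma> k b \<tau>)"

definition optimal_bid ::
  "'w measure \<Rightarrow> (nat \<Rightarrow> 'w \<Rightarrow> real) \<Rightarrow> (nat \<Rightarrow> 'w \<Rightarrow> real) \<Rightarrow> real \<Rightarrow> (real \<Rightarrow> real) \<Rightarrow> real \<Rightarrow> real"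
where
  "optimal_bid M T C \<gamma> k \<tau> =
     max 0 (k \<tau> + optimal_value M T C \<gamma> k 0 - optimal_value M T C \<gamma> k \<tau>)"

end

theory Submission
  imports Defs
begin

text \<open>The optimal value is the least solution \<open>V\<close> of the Bellman equation
  \<open>V a = E (exp (- \<gamma> S) max (V (a + S)) (k (a + S) + V 0 - C))\<close> with \<open>S\<close> exponential: along any
  policy the discounted value plus the gains so far is a supermartingale, and a martingale for the
  bid \<open>max 0 (k + V 0 - V)\<close>. If \<open>U\<close> grows at most as fast as \<open>k\<close>, then so does the maximum above
  with \<open>U\<close> in place of \<open>V\<close>. By concavity the increments of \<open>k\<close> shrink under the shift by \<open>S\<close>, so
  after averaging they are bounded by \<open>\<mu> / (\<mu> + \<gamma>)\<close> times the unshifted ones. Hence \<open>V\<close>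
  increases at most \<open>\<mu> / (\<mu> + \<gamma>) < 1\<close> times as fast as \<open>k\<close>, and \<open>k + V 0 - V\<close> is nonnegative
  and increases wherever \<open>k\<close> does.\<close>

subsection \<open>The Bellman equation\<close>

text \<open>The points \<open>x + s\<close> and \<open>y\<close> are convex combinations of the
  outer points \<open>x\<close> and \<open>y + s\<close> with swapped weights. Adding the two
  concavity inequalities cancels the weights.\<close>

lemma concave_on_increment_antimono:
  fixes f :: "real \<Rightarrow> real"
  assumes f: "concave_on {0..} f" and "0 \<le> x" "x \<le> y" "0 \<le> s"
  shows "f (y + s) - f (x + s) \<le> f y - f x"
proof (cases "y - x + s = 0")
  case True
  then have "s = 0" "y = x" using assms by linarith+
  then show ?thesis by simp
next
  case False
  define u where "u = s / (y - x + s)"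
  have pos: "0 < y - x + s" using False assms by simp
  have u: "0 \<le> u" "u \<le> 1" using pos assms by (auto simp: u_def)
  have "u * (y - x + s) = s" using pos by (simp add: u_def)
  then have *: "(1 - u) * x + u * (y + s) = x + s" "u * x + (1 - u) * (y + s) = y"
    by (simp_all add: algebra_simps)
  have "(1 - u) * f x + u * f (y + s) \<le> f (x + s)"
    using concave_onD[OF f u, of x "y + s"] assms * by simp
  moreover have "u * f x + (1 - u) * f (y + s) \<le> f y"
    using concave_onD[OF f, of "1 - u" x "y + s"] u assms * by simp
  ultimately show ?thesis by (simp add: algebra_simps)
qed

section \<open>Auxiliary facts on extended nonnegative reals and the exponential law\<close>

lemma borel_measurable_mono_ennreal:
  fixes f :: "real \<Rightarrow> ennreal"
  assumes "mono f" and "\<And>x. f x < \<top>"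
  shows "f \<in> borel_measurable borel"
proof -
  have "mono (\<lambda>x. enn2real (f x))"
    using assms by (auto simp: mono_def intro!: enn2real_mono)
  then have [measurable]: "(\<lambda>x. enn2real (f x)) \<in> borel_measurable borel"
    by (rule borel_measurable_mono)
  have "(\<lambda>x. ennreal (enn2real (f x))) \<in> borel_measurable borel" by measurable
  then show ?thesis using assms(2) by (simp add: less_top)
qed

text \<open>Only an inequality, because \<open>a - c\<close> is cut off at 0 when
  \<open>a < c\<close>.\<close>

lemma ennreal_add_diff_le: "a + ennreal r - c \<le> (a - c) + ennreal r"
proof -
  \<comment> \<open>The second conjunct is the side condition of
    \<open>ennreal_minus_le_iff\<close>; it reflects that infinity minus infinity is infinity in
    \<open>ennreal\<close>.\<close>
  have "a \<le> c + (a - c) \<and> (a = \<top> \<and> c = \<top> \<longrightarrow> a - c = \<top>)"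
    using ennreal_minus_le_iff[of a c "a - c"] by simp
  then show ?thesis
    by (auto simp: ennreal_minus_le_iff add.assoc[symmetric] intro: add_right_mono)
qed

abbreviation exponential :: "real \<Rightarrow> real measure" where
  "exponential r \<equiv> density lborel (\<lambda>x. ennreal (exponential_density r x))"

text \<open>Exponential tilting: the discount times the density of rate \<open>r\<close> is
  \<open>r / (r + g)\<close> times the density of rate \<open>r + g\<close>, which has mass
  1.\<close>

lemma nn_integral_exponential_discount:
  assumes "0 < r" "0 < g"
  shows "(\<integral>\<^sup>+s. ennreal (exp (- g * s)) \<partial>exponential r) = ennreal (r / (r + g))"
proof -
  interpret E: prob_space "exponential (r + g)"
    using assms by (intro prob_space_exponential_density) auto
  have "(\<integral>\<^sup>+s. ennreal (exp (- g * s)) \<partial>exponential r)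
      = (\<integral>\<^sup>+s. ennreal (exponential_density r s) * ennreal (exp (- g * s)) \<partial>lborel)"
    by (subst nn_integral_density) auto
  also have "\<dots> = (\<integral>\<^sup>+s. ennreal (r / (r + g)) * (ennreal (exponential_density (r + g) s) * 1) \<partial>lborel)"
    using assms by (intro nn_integral_cong)
      (auto simp: exponential_density_def ennreal_mult[symmetric] field_simps exp_add[symmetric] exp_diff[symmetric])
  also have "\<dots> = ennreal (r / (r + g)) * (\<integral>\<^sup>+s. 1 \<partial>exponential (r + g))"
    by (subst nn_integral_density) (auto simp: nn_integral_cmult)
  also have "\<dots> = ennreal (r / (r + g))"
    using E.emeasure_space_1 by simp
  finally show ?thesis .
qed

lemma AE_exponential_nonneg: "AE s in exponential r. 0 \<le> s"
  by (subst AE_density) (auto simp: exponential_density_def)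

section \<open>The Bellman operator and its least fixed point\<close>

text \<open>The data of the control problem without the sample space: \<open>D\<close> is the law of
  one price, and \<open>\<kappa>\<close> will be \<open>k\<close> continued to negative ages by the
  constant \<open>k 0\<close>. This continuation is monotone on the whole line but in general
  concave only on \<open>{0..}\<close>.\<close>

locale dynamic_value =
  fixes \<mu> \<gamma> K :: real and D :: "real measure" and \<kappa> :: "real \<Rightarrow> real"
  assumes \<mu>: "0 < \<mu>" and \<gamma>: "0 < \<gamma>"
    and D: "prob_space D" and sets_D [measurable_cong]: "sets D = sets borel"
    and \<kappa>_mono: "mono \<kappa>" and \<kappa>_nonneg: "\<And>x. 0 \<le> \<kappa> x" and \<kappa>_le: "\<And>x. \<kappa> x \<le> K"
    and \<kappa>_concave: "concave_on {0..} \<kappa>"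
begin

text \<open>\<open>\<rho>\<close> is the expected discount over one gap. \<open>L\<close> bounds
  every policy value: it is \<open>K\<close> times the sum of \<open>\<rho> ^ n\<close> over
  \<open>n \<ge> 1\<close>, equivalently the solution of
  \<open>L = \<rho> * (K + L)\<close>.\<close>

abbreviation "\<rho> \<equiv> \<mu> / (\<mu> + \<gamma>)"
abbreviation "L \<equiv> K * \<mu> / \<gamma>"

text \<open>Optimal gain from an auction at age \<open>x\<close> and price \<open>c\<close> when \<open>U\<close> is the value of the age
  afterwards. The truncated subtraction of \<open>ennreal\<close> is harmless below the maximum.\<close>

definition continuation :: "(real \<Rightarrow> ennreal) \<Rightarrow> real \<Rightarrow> real \<Rightarrow> ennreal" where
  "continuation U x c = max (U x) (ennreal (\<kappa> x) + U 0 - ennreal c)"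

definition bellman :: "(real \<Rightarrow> ennreal) \<Rightarrow> real \<Rightarrow> ennreal" where
  "bellman U a =
     (\<integral>\<^sup>+s. \<integral>\<^sup>+c. ennreal (exp (- \<gamma> * s)) * continuation U (a + s) c \<partial>D \<partial>exponential \<mu>)"

text \<open>Taken in the complete lattice of all functions into \<open>ennreal\<close>, so existence
  needs only monotonicity of \<open>bellman\<close>; boundedness and measurability are derived
  afterwards.\<close>

definition "V = lfp bellman"

lemma K_nonneg: "0 \<le> K" and L_nonneg: "0 \<le> L"
proof -
  show "0 \<le> K" using \<kappa>_nonneg[of 0] \<kappa>_le[of 0] by linarith
  then show "0 \<le> L" using \<mu> \<gamma> by simp
qed

lemma \<kappa>_measurable [measurable]: "\<kappa> \<in> borel_measurable borel"
  by (rule borel_measurable_mono[OF \<kappa>_mono])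

lemma continuation_measurable [measurable]:
  assumes [measurable]: "U \<in> borel_measurable borel"
  shows "(\<lambda>(x, c). continuation U x c) \<in> borel_measurable (borel \<Otimes>\<^sub>M borel)"
  unfolding continuation_def by measurable

lemma continuation_mono: "U \<le> U' \<Longrightarrow> continuation U x c \<le> continuation U' x c"
  unfolding continuation_def
  by (intro max.mono ennreal_minus_mono add_mono) (auto dest: le_funD)

lemma mono_bellman: "mono bellman"
  unfolding mono_def bellman_def
  by (intro allI impI le_funI nn_integral_mono mult_left_mono continuation_mono zero_le)
    (auto dest: le_funD)

lemma V_unfold: "V = bellman V"
  unfolding V_def by (rule lfp_unfold[OF mono_bellman])

lemma discount_integral: "(\<integral>\<^sup>+s. ennreal (exp (- \<gamma> * s)) \<partial>exponential \<mu>) = ennreal \<rho>"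
  by (rule nn_integral_exponential_discount[OF \<mu> \<gamma>])

text \<open>The integral over prices is kept, although its integrand is constant, to match the shape
  of \<open>bellman\<close>.\<close>

lemma discount_integral_const:
  "(\<integral>\<^sup>+s. \<integral>\<^sup>+c. ennreal (exp (- \<gamma> * s)) * d \<partial>D \<partial>exponential \<mu>) = ennreal \<rho> * d"
proof -
  interpret D: prob_space D by (rule D)
  have "(\<integral>\<^sup>+s. \<integral>\<^sup>+c. ennreal (exp (- \<gamma> * s)) * d \<partial>D \<partial>exponential \<mu>)
      = (\<integral>\<^sup>+s. ennreal (exp (- \<gamma> * s)) * d \<partial>exponential \<mu>)"
    by (simp add: D.emeasure_space_1)
  also have "\<dots> = ennreal \<rho> * d"
    by (subst nn_integral_multc) (measurable, simp only: discount_integral)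
  finally show ?thesis .
qed

text \<open>The class of functions in which the least fixed point is located; it is closed under
  arbitrary suprema and invariant under \<open>bellman\<close>, the last clause because of concavity.\<close>

definition admissible_value :: "(real \<Rightarrow> ennreal) \<Rightarrow> bool" where
  "admissible_value U \<longleftrightarrow> mono U \<and> (\<forall>x. U x \<le> ennreal L) \<and>
     (\<forall>x y. 0 \<le> x \<longrightarrow> x \<le> y \<longrightarrow> U y \<le> U x + ennreal \<rho> * ennreal (\<kappa> y - \<kappa> x))"

lemma admissible_measurable: "admissible_value U \<Longrightarrow> U \<in> borel_measurable borel"
  by (rule borel_measurable_mono_ennreal)
    (auto simp: admissible_value_def intro: le_less_trans ennreal_less_top)

lemma \<rho>_le_1: "ennreal \<rho> \<le> 1"
  using \<mu> \<gamma> by (simp add: ennreal_le_1)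

text \<open>Both arguments of the maximum grow by at most the increment of \<open>\<kappa>\<close>:
  the value by admissibility and \<open>\<rho> \<le> 1\<close>, the winning branch because only
  \<open>\<kappa>\<close> changes in it.\<close>

lemma continuation_increment:
  assumes U: "admissible_value U" and xy: "0 \<le> x" "x \<le> y"
  shows "continuation U y c \<le> continuation U x c + ennreal (\<kappa> y - \<kappa> x)"
proof -
  have "U y \<le> U x + ennreal \<rho> * ennreal (\<kappa> y - \<kappa> x)"
    using U xy by (auto simp: admissible_value_def)
  also have "\<dots> \<le> U x + ennreal (\<kappa> y - \<kappa> x)"
    using mult_right_mono[OF \<rho>_le_1, of "ennreal (\<kappa> y - \<kappa> x)"] by (intro add_left_mono) auto
  finally have 1: "U y \<le> U x + ennreal (\<kappa> y - \<kappa> x)" .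
  have "ennreal (\<kappa> y) = ennreal (\<kappa> x) + ennreal (\<kappa> y - \<kappa> x)"
    using \<kappa>_nonneg monoD[OF \<kappa>_mono xy(2)] by (subst ennreal_plus[symmetric]) auto
  then have "ennreal (\<kappa> y) + U 0 - ennreal c
      = (ennreal (\<kappa> x) + U 0) + ennreal (\<kappa> y - \<kappa> x) - ennreal c"
    by (simp only: add.assoc add.commute[of "U 0"])
  also have "\<dots> \<le> (ennreal (\<kappa> x) + U 0 - ennreal c) + ennreal (\<kappa> y - \<kappa> x)"
    by (rule ennreal_add_diff_le)
  finally have 2: "ennreal (\<kappa> y) + U 0 - ennreal c
      \<le> (ennreal (\<kappa> x) + U 0 - ennreal c) + ennreal (\<kappa> y - \<kappa> x)" .
  show ?thesis
    unfolding continuation_def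
    by (intro max.boundedI order_trans[OF 1] order_trans[OF 2] add_right_mono) auto
qed

lemma admissible_bellman:
  assumes U: "admissible_value U"
  shows "admissible_value (bellman U)"
proof -
  interpret D: prob_space D by (rule D)
  have [measurable]: "U \<in> borel_measurable borel" by (rule admissible_measurable[OF U])
  have mono_U: "mono U" and U_le: "\<And>x. U x \<le> ennreal L"
    using U by (auto simp: admissible_value_def)
  have "mono (bellman U)"
    unfolding mono_def bellman_def continuation_def
    by (intro allI impI nn_integral_mono mult_left_mono max.mono ennreal_minus_mono add_mono
        ennreal_leI monoD[OF mono_U] monoD[OF \<kappa>_mono]) auto
  moreover have "bellman U x \<le> ennreal L" for x
  proof -
    have "continuation U y c \<le> ennreal (K + L)" for y c
    proof -
      have "ennreal (\<kappa> y) + U 0 - ennreal c \<le> ennreal (\<kappa> y) + U 0"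
        by (rule diff_le_self_ennreal)
      also have "\<dots> \<le> ennreal K + ennreal L"
        by (intro add_mono ennreal_leI \<kappa>_le U_le)
      also have "\<dots> = ennreal (K + L)" using K_nonneg L_nonneg by simp
      finally have 1: "ennreal (\<kappa> y) + U 0 - ennreal c \<le> ennreal (K + L)" .
      have "U y \<le> ennreal L" by (rule U_le)
      also have "\<dots> \<le> ennreal (K + L)" using K_nonneg by (intro ennreal_leI) simp
      finally show ?thesis unfolding continuation_def using 1 by simp
    qed
    then have "bellman U x \<le> (\<integral>\<^sup>+s. \<integral>\<^sup>+c. ennreal (exp (- \<gamma> * s)) * ennreal (K + L) \<partial>D \<partial>exponential \<mu>)"
      unfolding bellman_def by (intro nn_integral_mono mult_left_mono) auto
    also have "\<dots> = ennreal \<rho> * ennreal (K + L)" by (rule discount_integral_const)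
    also have "\<dots> = ennreal (\<rho> * (K + L))"
      using \<mu> \<gamma> K_nonneg L_nonneg by (intro ennreal_mult[symmetric]) auto
    \<comment> \<open>This equation dictates the choice of \<open>L\<close>.\<close>
    also have "\<rho> * (K + L) = L" using \<mu> \<gamma> by (simp add: divide_simps) (simp add: algebra_simps)
    finally show ?thesis .
  qed
  moreover have "bellman U y \<le> bellman U x + ennreal \<rho> * ennreal (\<kappa> y - \<kappa> x)"
    if xy: "0 \<le> x" "x \<le> y" for x y
  proof -
    have *: "continuation U (y + s) c \<le> continuation U (x + s) c + ennreal (\<kappa> y - \<kappa> x)"
      if "0 \<le> s" for s c
    proof -
      have "continuation U (y + s) c
          \<le> continuation U (x + s) c + ennreal (\<kappa> (y + s) - \<kappa> (x + s))"
        using xy that by (intro continuation_increment[OF U]) auto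
      also have "\<dots> \<le> continuation U (x + s) c + ennreal (\<kappa> y - \<kappa> x)"
        by (intro add_left_mono ennreal_leI concave_on_increment_antimono[OF \<kappa>_concave] xy that)
      finally show ?thesis .
    qed
    have "bellman U y \<le> (\<integral>\<^sup>+s. \<integral>\<^sup>+c. ennreal (exp (- \<gamma> * s)) * continuation U (x + s) c
        + ennreal (exp (- \<gamma> * s)) * ennreal (\<kappa> y - \<kappa> x) \<partial>D \<partial>exponential \<mu>)"
      unfolding bellman_def distrib_left[symmetric]
      \<comment> \<open>The pointwise bound holds only for \<open>0 \<le> s\<close>, which is almost
        sure under the exponential law.\<close>
      by (rule nn_integral_mono_AE, rule AE_mp[OF AE_exponential_nonneg[of \<mu>]], rule AE_I2)
        (intro impI nn_integral_mono mult_left_mono * zero_le)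
    also have "\<dots> = (\<integral>\<^sup>+s. (\<integral>\<^sup>+c. ennreal (exp (- \<gamma> * s)) * continuation U (x + s) c \<partial>D)
        + (\<integral>\<^sup>+c. ennreal (exp (- \<gamma> * s)) * ennreal (\<kappa> y - \<kappa> x) \<partial>D) \<partial>exponential \<mu>)"
      by (intro nn_integral_cong nn_integral_add) measurable
    \<comment> \<open>The increment no longer depends on \<open>s\<close>, so averaging the discount
      yields exactly the factor \<open>\<rho>\<close> that admissibility demands.\<close>
    also have "\<dots> = bellman U x + ennreal \<rho> * ennreal (\<kappa> y - \<kappa> x)"
      unfolding bellman_def discount_integral_const[symmetric]
      by (intro nn_integral_add) measurable
    finally show ?thesis .
  qed
  ultimately show ?thesis by (auto simp: admissible_value_def)
qed

text \<open>Ordinal induction requires closure under suprema of arbitrary, possibly uncountable,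
  families. Measurability lacks this closure; monotonicity has it and implies measurability.\<close>

lemma admissible_V: "admissible_value V"
  unfolding V_def
proof (rule lfp_ordinal_induct[OF mono_bellman])
  fix \<U> :: "(real \<Rightarrow> ennreal) set" assume \<U>: "\<forall>U\<in>\<U>. admissible_value U"
  show "admissible_value (Sup \<U>)"
    unfolding admissible_value_def
  proof (intro conjI allI impI monoI)
    fix x y :: real assume "x \<le> y"
    then have "U x \<le> U y" if "U \<in> \<U>" for U
      using \<U> that by (auto simp: admissible_value_def dest: monoD)
    then show "Sup \<U> x \<le> Sup \<U> y" by (auto intro!: SUP_mono)
  next
    fix x show "Sup \<U> x \<le> ennreal L"
      using \<U> by (auto simp: admissible_value_def intro!: SUP_least)
  next
    fix x y :: real assume xy: "0 \<le> x" "x \<le> y"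
    have "U y \<le> Sup \<U> x + ennreal \<rho> * ennreal (\<kappa> y - \<kappa> x)" if "U \<in> \<U>" for U
    proof -
      have "U y \<le> U x + ennreal \<rho> * ennreal (\<kappa> y - \<kappa> x)"
        using \<U> that xy by (auto simp: admissible_value_def)
      also have "\<dots> \<le> Sup \<U> x + ennreal \<rho> * ennreal (\<kappa> y - \<kappa> x)"
        using that by (intro add_right_mono) (auto intro: SUP_upper)
      finally show ?thesis .
    qed
    then show "Sup \<U> y \<le> Sup \<U> x + ennreal \<rho> * ennreal (\<kappa> y - \<kappa> x)"
      by (auto intro!: SUP_least)
  qed
qed (rule admissible_bellman)

lemma V_measurable [measurable]: "V \<in> borel_measurable borel"
  by (rule admissible_measurable[OF admissible_V])

lemma V_le: "V x \<le> ennreal L" and V_increment: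
  "0 \<le> x \<Longrightarrow> x \<le> y \<Longrightarrow> V y \<le> V x + ennreal \<rho> * ennreal (\<kappa> y - \<kappa> x)"
  using admissible_V by (auto simp: admissible_value_def)

section \<open>The fixed point as a real function\<close>

definition "v x = enn2real (V x)"

lemma v_nonneg: "0 \<le> v x" by (simp add: v_def)

lemma V_eq: "V x = ennreal (v x)"
  using le_less_trans[OF V_le ennreal_less_top, of x] by (simp add: v_def)

lemma v_measurable [measurable]: "v \<in> borel_measurable borel"
  unfolding v_def by measurable

lemma v_increment:
  assumes "0 \<le> x" "x \<le> y"
  shows "v y - v x \<le> \<rho> * (\<kappa> y - \<kappa> x)"
proof -
  have *: "0 \<le> \<rho>" "0 \<le> \<kappa> y - \<kappa> x" using \<mu> \<gamma> monoD[OF \<kappa>_mono assms(2)] by auto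
  have "ennreal (v y) \<le> ennreal (v x + \<rho> * (\<kappa> y - \<kappa> x))"
    using V_increment[OF assms] by (simp only: V_eq ennreal_mult[OF *] ennreal_plus[OF v_nonneg mult_nonneg_nonneg[OF *]])
  moreover have "0 \<le> v x + \<rho> * (\<kappa> y - \<kappa> x)"
    using * v_nonneg[of x] by (intro add_nonneg_nonneg mult_nonneg_nonneg)
  ultimately show ?thesis by (simp only: ennreal_le_iff)
qed

lemma continuation_V:
  "0 \<le> c \<Longrightarrow> continuation V x c = ennreal (max (v x) (\<kappa> x + v 0 - c))"
  using \<kappa>_nonneg[of x] v_nonneg[of 0] v_nonneg[of x]
  by (simp add: continuation_def V_eq ennreal_plus[symmetric] ennreal_minus ennreal_max_0
      del: ennreal_plus) (simp add: max_def ennreal_le_iff2 ennreal_neg)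

end

subsection \<open>Independence of the next auction from the past\<close>

text \<open>A sample point is a function on \<open>nat + nat\<close>, with gaps at \<open>Inl i\<close> and prices at \<open>Inr i\<close>.
  Unlike \<open>age\<close>, \<open>age_after \<dots> n\<close> is the age just after auction \<open>n - 1\<close>, so that it and
  \<open>elapsed \<dots> n\<close> depend on the coordinates below \<open>n\<close> only.\<close>

primrec age_after :: "(real \<Rightarrow> real) \<Rightarrow> real \<Rightarrow> (nat + nat \<Rightarrow> real) \<Rightarrow> nat \<Rightarrow> real" where
  "age_after b \<tau> z 0 = \<tau>"
| "age_after b \<tau> z (Suc n) =
     (if b (age_after b \<tau> z n + z (Inl n)) > z (Inr n) then 0 else age_after b \<tau> z n + z (Inl n))"

definition elapsed :: "(nat + nat \<Rightarrow> real) \<Rightarrow> nat \<Rightarrow> real" where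
  "elapsed z n = (\<Sum>i<n. z (Inl i))"

definition past :: "nat \<Rightarrow> (nat + nat) set" where
  "past n = Inl ` {..<n} \<union> Inr ` {..<n}"

lemma past_simps [simp]: "Inl i \<in> past n \<longleftrightarrow> i < n" "Inr i \<in> past n \<longleftrightarrow> i < n"
  by (auto simp: past_def)

lemma past_Suc_subset: "past (Suc n) \<subseteq> J \<longleftrightarrow> past n \<subseteq> J \<and> Inl n \<in> J \<and> Inr n \<in> J"
  by (auto simp: past_def lessThan_Suc)

text \<open>Exhibits the state as a function of past coordinates, as independence arguments require.
  A fixed \<open>J\<close> containing \<open>past n\<close> lets the induction run, since
  \<open>past n\<close> itself changes with \<open>n\<close>.\<close>

lemma age_after_restrict: "past n \<subseteq> J \<Longrightarrow> age_after b \<tau> (restrict z J) n = age_after b \<tau> z n"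
  by (induction n) (auto simp: past_Suc_subset)

lemma elapsed_restrict: "elapsed (restrict z (past n)) n = elapsed z n"
  by (simp add: elapsed_def)

lemma age_after_measurable:
  assumes [measurable]: "b \<in> borel_measurable borel" and "past n \<subseteq> J"
  shows "(\<lambda>z. age_after b \<tau> z n) \<in> borel_measurable (Pi\<^sub>M J (\<lambda>_. borel))"
  using assms(2)
proof (induction n)
  case 0
  then show ?case by simp
next
  case (Suc n)
  then have [measurable]: "(\<lambda>z. age_after b \<tau> z n) \<in> borel_measurable (Pi\<^sub>M J (\<lambda>_. borel))"
    "(\<lambda>z. z (Inl n)) \<in> borel_measurable (Pi\<^sub>M J (\<lambda>_. borel))"
    "(\<lambda>z. z (Inr n)) \<in> borel_measurable (Pi\<^sub>M J (\<lambda>_. borel))"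
    by (auto simp: past_Suc_subset intro: measurable_component_singleton)
  show ?case unfolding age_after.simps by measurable
qed

lemma elapsed_measurable: "(\<lambda>z. elapsed z n) \<in> borel_measurable (Pi\<^sub>M (past n) (\<lambda>_. borel))"
  unfolding elapsed_def
  by (intro borel_measurable_sum measurable_component_singleton) simp

section \<open>Joint independence of all gaps and prices\<close>

context auctions
begin

definition increments :: "'w \<Rightarrow> nat + nat \<Rightarrow> real" where
  "increments w = case_sum (\<lambda>i. gap T i w) (\<lambda>i. C i w)"

lemma increments_simps [simp]:
  "increments w (Inl i) = gap T i w" "increments w (Inr i) = C i w"
  by (simp_all add: increments_def)

lemma gap_measurable [measurable]: "gap T i \<in> borel_measurable M"
  using gaps_indep by (auto simp: indep_vars_def)

lemma C_measurable [measurable]: "C i \<in> borel_measurable M"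
  using prices_indep by (auto simp: indep_vars_def)

lemma increments_measurable: "(\<lambda>w. increments w j) \<in> borel_measurable M"
  by (cases j) (auto intro: gap_measurable C_measurable)

text \<open>Mind the shift: \<open>elapsed\<close> at \<open>n\<close> is the time of auction
  \<open>n - 1\<close>, or 0 if \<open>n = 0\<close>.\<close>

lemma elapsed_Suc: "elapsed (increments w) (Suc n) = T n w"
  by (induction n) (auto simp: elapsed_def gap_def)

lemma age_eq: "age b \<tau> (\<lambda>j. T j w) (\<lambda>j. C j w) n = age_after b \<tau> (increments w) n + gap T n w"
  by (induction n) (simp_all add: gap_def)

lemma age_nonneg:
  assumes "w \<in> space M" "0 \<le> \<tau>"
  shows "0 \<le> age b \<tau> (\<lambda>j. T j w) (\<lambda>j. C j w) n"
proof (induction n)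
  case 0
  then show ?case using first_arrival_pos[OF assms(1)] assms(2) by simp
next
  case (Suc n)
  then show ?case using arrivals_increasing[OF assms(1), of n] by auto
qed

text \<open>The gap sequence is a measurable function of the arrival sequence, so it inherits
  independence from the prices.\<close>

lemma indep_gaps_prices:
  "indep_var (\<Pi>\<^sub>M i\<in>(UNIV :: nat set). (borel :: real measure)) (\<lambda>w i. gap T i w)
             (\<Pi>\<^sub>M i\<in>(UNIV :: nat set). (borel :: real measure)) (\<lambda>w i. C i w)"
proof -
  let ?P = "\<Pi>\<^sub>M i\<in>(UNIV :: nat set). (borel :: real measure)"
  let ?g = "\<lambda>t i. (case i of 0 \<Rightarrow> t 0 | Suc j \<Rightarrow> t (Suc j) - t j) :: real"
  have "?g \<in> ?P \<rightarrow>\<^sub>M ?P"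
    by (intro measurable_PiM_single') (auto split: nat.split)
  then have "indep_var ?P (?g \<circ> (\<lambda>w i. T i w)) ?P (id \<circ> (\<lambda>w i. C i w))"
    by (intro indep_var_compose[OF prices_indep_arrivals]) auto
  then show ?thesis by (simp add: comp_def gap_def)
qed

text \<open>Includes the empty index set, which \<open>indep_varsD\<close> excludes but which arises
  when a finite set contains only gaps or only prices.\<close>

lemma prob_indep_vars_Ball:
  assumes X: "indep_vars (\<lambda>_. borel) X (UNIV :: nat set)" and "finite J" "\<And>i. A i \<in> sets borel"
  shows "prob {w \<in> space M. \<forall>i\<in>J. X i w \<in> (A i :: real set)} = (\<Prod>i\<in>J. prob (X i -` A i \<inter> space M))"
proof (cases "J = {}")
  case True
  then show ?thesis by (simp add: prob_space)
next
  case False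
  then have "{w \<in> space M. \<forall>i\<in>J. X i w \<in> A i} = (\<Inter>i\<in>J. X i -` A i \<inter> space M)" by auto
  then show ?thesis using indep_varsD[OF X False, of A] assms by simp
qed

text \<open>A finite set of coordinates splits into gaps and prices. Independence of the two
  sequences separates the blocks, and independence within each sequence factors them
  further.\<close>

lemma indep_increments: "indep_vars (\<lambda>_. borel) (\<lambda>j w. increments w j) UNIV"
  unfolding indep_vars_def2
proof (intro conjI ballI increments_measurable indep_setsI)
  fix j show "{(\<lambda>w. increments w j) -` A \<inter> space M |A. A \<in> sets borel} \<subseteq> events"
    by (auto intro: measurable_sets increments_measurable)
next
  let ?P = "\<Pi>\<^sub>M i\<in>(UNIV :: nat set). (borel :: real measure)"
  fix S and J :: "(nat + nat) set" assume J: "J \<noteq> {}" "finite J"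
    and S: "\<forall>j\<in>J. S j \<in> {(\<lambda>w. increments w j) -` A \<inter> space M |A. A \<in> sets borel}"
  \<comment> \<open>Choosing a Borel set also for \<open>j\<close> outside \<open>J\<close> makes
    \<open>A j\<close> measurable without a side condition.\<close>
  from S have "\<forall>j. \<exists>A. A \<in> sets borel \<and> (j \<in> J \<longrightarrow> S j = (\<lambda>w. increments w j) -` A \<inter> space M)"
    by blast
  then obtain A where A: "\<And>j. A j \<in> sets borel"
    "\<And>j. j \<in> J \<Longrightarrow> S j = (\<lambda>w. increments w j) -` A j \<inter> space M"
    by metis
  define J1 J2 where "J1 = Inl -` J" and "J2 = Inr -` J"
  have fin: "finite J1" "finite J2"
    using J by (auto simp: J1_def J2_def intro: finite_vimageI)
  have J_eq: "J = Inl ` J1 \<union> Inr ` J2"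
  proof (rule set_eqI)
    show "j \<in> J \<longleftrightarrow> j \<in> Inl ` J1 \<union> Inr ` J2" for j
      by (cases j) (auto simp: J1_def J2_def)
  qed
  let ?A1 = "{f \<in> space ?P. \<forall>i\<in>J1. f i \<in> A (Inl i)}" and ?A2 = "{f \<in> space ?P. \<forall>i\<in>J2. f i \<in> A (Inr i)}"
  have sets: "?A1 \<in> sets ?P" "?A2 \<in> sets ?P"
    using fin A(1) by measurable
  have "prob (\<Inter>j\<in>J. S j) =
      prob ((\<lambda>w. (\<lambda>i. gap T i w, \<lambda>i. C i w)) -` (?A1 \<times> ?A2) \<inter> space M)"
  proof (rule arg_cong[where f = prob])
    have "(\<Inter>j\<in>J. S j) = {w \<in> space M. \<forall>j\<in>J. increments w j \<in> A j}"
      using J(1) A(2) by auto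
    then show "(\<Inter>j\<in>J. S j) = (\<lambda>w. (\<lambda>i. gap T i w, \<lambda>i. C i w)) -` (?A1 \<times> ?A2) \<inter> space M"
      by (auto simp: J_eq space_PiM ball_Un)
  qed
  also have "\<dots> = prob ((\<lambda>w i. gap T i w) -` ?A1 \<inter> space M) * prob ((\<lambda>w i. C i w) -` ?A2 \<inter> space M)"
    by (rule indep_varD[OF indep_gaps_prices sets])
  also have "(\<lambda>w i. gap T i w) -` ?A1 \<inter> space M = {w \<in> space M. \<forall>i\<in>J1. gap T i w \<in> A (Inl i)}"
    by (auto simp: space_PiM)
  also have "(\<lambda>w i. C i w) -` ?A2 \<inter> space M = {w \<in> space M. \<forall>i\<in>J2. C i w \<in> A (Inr i)}"
    by (auto simp: space_PiM)
  also have "prob {w \<in> space M. \<forall>i\<in>J1. gap T i w \<in> A (Inl i)} = (\<Prod>i\<in>J1. prob (S (Inl i)))"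
    using A(2) by (subst prob_indep_vars_Ball[OF gaps_indep fin(1) A(1)]) (auto simp: J1_def intro!: prod.cong)
  also have "prob {w \<in> space M. \<forall>i\<in>J2. C i w \<in> A (Inr i)} = (\<Prod>i\<in>J2. prob (S (Inr i)))"
    using A(2) by (subst prob_indep_vars_Ball[OF prices_indep fin(2) A(1)]) (auto simp: J2_def intro!: prod.cong)
  also have "(\<Prod>i\<in>J1. prob (S (Inl i))) * (\<Prod>i\<in>J2. prob (S (Inr i))) = (\<Prod>j\<in>J. prob (S j))"
    unfolding J_eq using fin
    by (subst prod.union_disjoint) (auto simp: prod.reindex)
  finally show "prob (\<Inter>j\<in>J. S j) = (\<Prod>j\<in>J. prob (S j))" .
qed

lemma distr_gap: "distr M borel (gap T n) = exponential \<mu>"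
proof -
  have "distr M borel (gap T n) = distr M lborel (gap T n)" by (rule distr_cong) auto
  also have "\<dots> = exponential \<mu>"
    using gaps_exponential[of n] by (simp add: distributed_def)
  finally show ?thesis .
qed

text \<open>\<open>win_prob\<close> fixes the laws on the open half-lines \<open>{..<b}\<close>, an
  intersection-stable generator of the Borel sets.\<close>

lemma distr_price: "distr M borel (C n) = distr M borel (C 0)"
proof (rule measure_eqI_generator_eq[where E = "range lessThan" and \<Omega> = UNIV and A = "\<lambda>i. {..<real i}"])
  show "Int_stable (range (lessThan :: real \<Rightarrow> real set))"
    by (auto simp: Int_stable_def) (metis Int_commute inf.absorb1 lessThan_subset_iff linorder_linear rangeI)
  show "sets (distr M borel (C n)) = sigma_sets UNIV (range lessThan)"
    "sets (distr M borel (C 0)) = sigma_sets UNIV (range lessThan)"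
    using arg_cong[OF borel_eq_lessThan[where 'a = real], of sets]
    by (simp_all add: eucl_lessThan)
  have *: "C m -` {..<x} \<inter> space M = {w \<in> space M. C m w < x}" for m x by auto
  show "emeasure (distr M borel (C n)) X = emeasure (distr M borel (C 0)) X" if "X \<in> range lessThan" for X
    using that by (auto simp: emeasure_distr emeasure_eq_measure * win_prob)
  show "(\<Union>i. {..<real i}) = UNIV" by (auto intro: reals_Archimedean2)
  interpret distr: prob_space "distr M borel (C n)" by (rule prob_space_distr) simp
  show "emeasure (distr M borel (C n)) {..<real i} \<noteq> \<infinity>" for i by simp
qed auto

text \<open>Given the past, the next gap and price may be integrated out under their own laws. The
  disjoint blocks \<open>past n\<close> and \<open>{Inl n, Inr n}\<close> are independent, and so
  are the two coordinates of the latter; Fubini applies to both product laws.\<close>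

lemma nn_integral_next_auction:
  assumes h: "h \<in> Pi\<^sub>M (past n) (\<lambda>_. borel) \<rightarrow>\<^sub>M S"
    and F: "(\<lambda>(x, s, c). F x s c) \<in> borel_measurable (S \<Otimes>\<^sub>M borel \<Otimes>\<^sub>M borel)"
  defines "past_state \<equiv> \<lambda>w. h (restrict (increments w) (past n))"
  shows "(\<integral>\<^sup>+w. F (past_state w) (gap T n w) (C n w) \<partial>M)
    = (\<integral>\<^sup>+w. \<integral>\<^sup>+s. \<integral>\<^sup>+c. F (past_state w) s c \<partial>distr M borel (C 0) \<partial>exponential \<mu> \<partial>M)"
proof -
  let ?D = "distr M borel (C 0)" and ?E = "exponential \<mu>"
  interpret D: prob_space ?D by (rule prob_space_distr) simp
  let ?P = "Pi\<^sub>M (past n) (\<lambda>_. borel :: real measure)"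
  let ?N = "Pi\<^sub>M {Inl n, Inr n} (\<lambda>_. borel :: real measure)"
  let ?X = "\<lambda>w. restrict (increments w) (past n)"
  let ?Y = "\<lambda>w. restrict (increments w) {Inl n, Inr n}"
  have X [measurable]: "?X \<in> M \<rightarrow>\<^sub>M ?P" and Y [measurable]: "?Y \<in> M \<rightarrow>\<^sub>M ?N"
    by (auto intro!: measurable_restrict increments_measurable)
  have [measurable]: "(\<lambda>y. y (Inl n)) \<in> borel_measurable ?N" "(\<lambda>y. y (Inr n)) \<in> borel_measurable ?N"
    by (auto intro!: measurable_component_singleton)
  have "indep_var ?P ?X ?N ?Y"
    by (rule indep_var_restrict[OF indep_increments]) auto
  then have joint: "distr M (?P \<Otimes>\<^sub>M ?N) (\<lambda>w. (?X w, ?Y w)) = distr M ?P ?X \<Otimes>\<^sub>M distr M ?N ?Y"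
    unfolding indep_var_distribution_eq by auto
  have "indep_var borel (\<lambda>w. increments w (Inl n)) borel (\<lambda>w. increments w (Inr n))"
    using indep_var_compose[OF indep_var_restrict[OF indep_increments, of "{Inl n}" "{Inr n}"],
        of "\<lambda>y. y (Inl n)" borel "\<lambda>y. y (Inr n)" borel]
    by (simp add: comp_def measurable_component_singleton)
  then have next_law: "distr M (borel \<Otimes>\<^sub>M borel) (\<lambda>w. (gap T n w, C n w)) = ?E \<Otimes>\<^sub>M ?D"
    unfolding indep_var_distribution_eq by (simp add: distr_gap distr_price[of n])
  interpret N: prob_space "distr M ?N ?Y" by (rule prob_space_distr) (rule Y)
  note [measurable] = h
  let ?F = "\<lambda>(x, y). (\<lambda>(x, s, c). F x s c) (h x, y (Inl n), y (Inr n))"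
  have F_PN: "?F \<in> borel_measurable (?P \<Otimes>\<^sub>M ?N)"
  proof -
    have "(\<lambda>p. snd p j) \<in> borel_measurable (?P \<Otimes>\<^sub>M ?N)" if "j \<in> {Inl n, Inr n}" for j
      using measurable_compose[OF measurable_snd measurable_component_singleton[OF that]] .
    then have "(\<lambda>p. (h (fst p), snd p (Inl n), snd p (Inr n))) \<in> ?P \<Otimes>\<^sub>M ?N \<rightarrow>\<^sub>M S \<Otimes>\<^sub>M borel \<Otimes>\<^sub>M borel"
      by (intro measurable_Pair measurable_compose[OF measurable_fst h]) auto
    from measurable_compose[OF this F] show ?thesis by (simp add: case_prod_beta')
  qed
  have Fx: "(\<lambda>(s, c). F x s c) \<in> borel_measurable (borel \<Otimes>\<^sub>M borel)" if "x \<in> space S" for x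
  proof -
    have "(\<lambda>y. (x, y)) \<in> borel \<Otimes>\<^sub>M borel \<rightarrow>\<^sub>M S \<Otimes>\<^sub>M (borel \<Otimes>\<^sub>M borel)" using that by measurable
    from measurable_compose[OF this F] show ?thesis by (simp add: case_prod_beta')
  qed
  have inner: "(\<integral>\<^sup>+y. F x (y (Inl n)) (y (Inr n)) \<partial>distr M ?N ?Y) = (\<integral>\<^sup>+s. \<integral>\<^sup>+c. F x s c \<partial>?D \<partial>?E)"
    if x: "x \<in> space S" for x
  proof -
    have "(\<integral>\<^sup>+y. F x (y (Inl n)) (y (Inr n)) \<partial>distr M ?N ?Y) = (\<integral>\<^sup>+w. F x (gap T n w) (C n w) \<partial>M)"
      using measurable_compose[OF _ Fx[OF x], of "\<lambda>y. (y (Inl n), y (Inr n))" ?N]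
      by (subst nn_integral_distr) auto
    also have "\<dots> = (\<integral>\<^sup>+p. (\<lambda>(s, c). F x s c) p \<partial>(?E \<Otimes>\<^sub>M ?D))"
      unfolding next_law[symmetric] using Fx[OF x] by (subst nn_integral_distr) auto
    also have "\<dots> = (\<integral>\<^sup>+s. \<integral>\<^sup>+c. F x s c \<partial>?D \<partial>?E)"
      using Fx[OF x] by (subst D.nn_integral_fst[symmetric]) (simp_all cong: measurable_cong_sets)
    finally show ?thesis .
  qed
  have "(\<integral>\<^sup>+w. F (past_state w) (gap T n w) (C n w) \<partial>M)
      = (\<integral>\<^sup>+p. ?F p \<partial>distr M (?P \<Otimes>\<^sub>M ?N) (\<lambda>w. (?X w, ?Y w)))"
    using F_PN by (subst nn_integral_distr) (simp_all add: past_state_def)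
  also have "\<dots> = (\<integral>\<^sup>+x. \<integral>\<^sup>+y. ?F (x, y) \<partial>distr M ?N ?Y \<partial>distr M ?P ?X)"
    unfolding joint using F_PN by (subst N.nn_integral_fst) (simp_all cong: measurable_cong_sets)
  also have "\<dots> = (\<integral>\<^sup>+x. \<integral>\<^sup>+s. \<integral>\<^sup>+c. F (h x) s c \<partial>?D \<partial>?E \<partial>distr M ?P ?X)"
    using measurable_space[OF h] inner by (intro nn_integral_cong) simp
  also have "\<dots> = (\<integral>\<^sup>+w. \<integral>\<^sup>+s. \<integral>\<^sup>+c. F (past_state w) s c \<partial>?D \<partial>?E \<partial>M)"
  proof -
    \<comment> \<open>Measurability of the iterated integral in the past is read off from the equal
      integral over the block law.\<close>
    have "(\<lambda>x. \<integral>\<^sup>+y. ?F (x, y) \<partial>distr M ?N ?Y) \<in> borel_measurable ?P"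
      using F_PN by (intro N.borel_measurable_nn_integral) (simp add: case_prod_beta' cong: measurable_cong_sets)
    then have "(\<lambda>x. \<integral>\<^sup>+s. \<integral>\<^sup>+c. F (h x) s c \<partial>?D \<partial>?E) \<in> borel_measurable ?P"
      using measurable_space[OF h] inner by (simp cong: measurable_cong)
    then show ?thesis by (subst nn_integral_distr) (simp_all add: past_state_def)
  qed
  finally show ?thesis .
qed

end

subsection \<open>Verification of the Bellman solution\<close>

lemma (in auctions) state_measurable:
  assumes "b \<in> borel_measurable borel"
  shows "(\<lambda>w. age_after b \<tau> (increments w) n) \<in> borel_measurable M"
proof -
  have "(\<lambda>w. restrict (increments w) (past n)) \<in> M \<rightarrow>\<^sub>M Pi\<^sub>M (past n) (\<lambda>_. borel)"
    by (auto intro!: measurable_restrict increments_measurable)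
  from measurable_compose[OF this age_after_measurable[OF assms order_refl]]
  show ?thesis by (simp add: age_after_restrict)
qed

lemma (in auctions) nn_integral_next_auction_age:
  assumes b: "b \<in> borel_measurable borel"
    and F: "(\<lambda>p. F (fst (fst p)) (snd (fst p)) (fst (snd p)) (snd (snd p))) \<in> borel_measurable ((borel \<Otimes>\<^sub>M borel) \<Otimes>\<^sub>M borel \<Otimes>\<^sub>M borel)"
  shows "(\<integral>\<^sup>+w. F (elapsed (increments w) n) (age_after b \<tau> (increments w) n) (gap T n w) (C n w) \<partial>M)
    = (\<integral>\<^sup>+w. \<integral>\<^sup>+s. \<integral>\<^sup>+c. F (elapsed (increments w) n) (age_after b \<tau> (increments w) n) s c
         \<partial>distr M borel (C 0) \<partial>exponential \<mu> \<partial>M)"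
proof -
  have "(\<lambda>z. (elapsed z n, age_after b \<tau> z n)) \<in> Pi\<^sub>M (past n) (\<lambda>_. borel) \<rightarrow>\<^sub>M borel \<Otimes>\<^sub>M borel"
    by (intro measurable_Pair elapsed_measurable age_after_measurable b order_refl)
  from nn_integral_next_auction[OF this, of "\<lambda>(t, a) s c. F t a s c"] F show ?thesis
    by (simp add: age_after_restrict elapsed_restrict case_prod_beta')
qed

text \<open>Composing with this retraction extends a policy to a Borel function on the whole
  line.\<close>

lemma max_0_measurable: "(\<lambda>x. max 0 x) \<in> borel \<rightarrow>\<^sub>M restrict_space borel {0::real..}"
  by (rule measurable_restrict_space2) auto

text \<open>Ages never become negative, so policies and \<open>k\<close> may be replaced by
  extensions to the whole line.\<close>

lemma (in auctions) policy_value_nonneg_ages: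
  assumes "0 \<le> \<tau>" and "\<And>x. 0 \<le> x \<Longrightarrow> b x = b' x" and "\<And>x. 0 \<le> x \<Longrightarrow> k x = k' x"
  shows "policy_value M T C \<gamma> k b \<tau> = policy_value M T C \<gamma> k' b' \<tau>"
proof -
  have "age b \<tau> (\<lambda>j. T j w) (\<lambda>j. C j w) n = age b' \<tau> (\<lambda>j. T j w) (\<lambda>j. C j w) n"
    if "w \<in> space M" for w n
  proof (induction n)
    case (Suc n)
    then show ?case using age_nonneg[OF that assms(1), of b n] assms(2) by simp
  qed simp
  then have "discounted_gain \<gamma> k b \<tau> (\<lambda>j. T j w) (\<lambda>j. C j w) n
      = discounted_gain \<gamma> k' b' \<tau> (\<lambda>j. T j w) (\<lambda>j. C j w) n" if "w \<in> space M" for w n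
    using that age_nonneg[OF that assms(1), of b' n] assms(2,3) by (simp add: discounted_gain_def)
  then show ?thesis
    unfolding policy_value_def by (intro arg_cong2[where f = minus] arg_cong[where f = enn2ereal] nn_integral_cong) simp_all
qed

context dynamic_value
begin

text \<open>The loss part is moved to the right-hand side so that every term is nonnegative.\<close>

lemma gain_plus_continuation_le:
  assumes "0 \<le> c" "0 \<le> e"
  shows "ennreal (e * (\<kappa> x - c) * of_bool win) + ennreal e * V (if win then 0 else x)
    \<le> ennreal e * continuation V x c + ennreal (- (e * (\<kappa> x - c) * of_bool win))"
    (is "?l \<le> ?r")
    and "(win \<longleftrightarrow> c < \<kappa> x + v 0 - v x) \<Longrightarrow>
    ennreal (e * (\<kappa> x - c) * of_bool win) + ennreal e * V (if win then 0 else x)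
    = ennreal e * continuation V x c + ennreal (- (e * (\<kappa> x - c) * of_bool win))"
proof -
  define g where "g = e * (\<kappa> x - c) * of_bool win"
  define u where "u = e * v (if win then 0 else x)"
  define m where "m = e * max (v x) (\<kappa> x + v 0 - c)"
  have nn: "0 \<le> u" "0 \<le> m"
    using assms v_nonneg by (auto simp: u_def m_def le_max_iff_disj intro!: mult_nonneg_nonneg)
  have *: "ennreal g + ennreal e * V (if win then 0 else x) = ennreal (max 0 g + u)"
    using nn assms by (subst ennreal_plus) (simp_all add: u_def V_eq ennreal_mult')
  have **: "ennreal e * continuation V x c + ennreal (- g) = ennreal (m + max 0 (- g))"
    using nn assms by (subst ennreal_plus) (simp_all add: m_def continuation_V ennreal_mult')
  \<comment> \<open>The positive part of \<open>g\<close> is \<open>g\<close> plus its negative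
    part, so only \<open>g + u\<close> and \<open>m\<close> remain to be compared.\<close>
  have eq: "max 0 g + u = (g + u) + max 0 (- g)" by simp
  have gu: "g + u = e * (if win then \<kappa> x + v 0 - c else v x)"
    by (simp add: g_def u_def algebra_simps)
  have "g + u \<le> m"
    unfolding gu m_def using assms by (intro mult_left_mono) auto
  then show "?l \<le> ?r"
    unfolding g_def[symmetric] * ** eq by (intro ennreal_leI add_right_mono)
  assume "win \<longleftrightarrow> c < \<kappa> x + v 0 - v x"
  \<comment> \<open>The winning condition says exactly that the second argument of the maximum in
    \<open>m\<close> is the larger one.\<close>
  then have "g + u = m" unfolding gu m_def by (auto simp: max_def)
  then show "?l = ?r"
    unfolding g_def[symmetric] * ** eq by simp
qed

end

section \<open>Discounted continuation value along a policy\<close>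

locale auction_problem =
  auctions M \<mu> T C q + dynamic_value \<mu> \<gamma> K "distr M borel (C 0)" \<kappa>
  for M :: "'w measure" and \<mu> \<gamma> K :: real and T C :: "nat \<Rightarrow> 'w \<Rightarrow> real" and q \<kappa> :: "real \<Rightarrow> real"
begin

abbreviation gain :: "(real \<Rightarrow> real) \<Rightarrow> real \<Rightarrow> nat \<Rightarrow> 'w \<Rightarrow> real" where
  "gain b \<tau> n w \<equiv> discounted_gain \<gamma> \<kappa> b \<tau> (\<lambda>j. T j w) (\<lambda>j. C j w) n"

definition remaining_value :: "(real \<Rightarrow> real) \<Rightarrow> real \<Rightarrow> nat \<Rightarrow> ennreal" where
  "remaining_value b \<tau> n =
     (\<integral>\<^sup>+w. ennreal (exp (- \<gamma> * elapsed (increments w) n)) * V (age_after b \<tau> (increments w) n) \<partial>M)"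

lemma elapsed_increments_measurable [measurable]:
  "(\<lambda>w. elapsed (increments w) n) \<in> borel_measurable M"
  unfolding elapsed_def by simp

lemma elapsed_increments_Suc: "elapsed (increments w) (Suc n) = elapsed (increments w) n + gap T n w"
  by (simp add: elapsed_def)

lemma gain_eq: "gain b \<tau> n w = exp (- \<gamma> * elapsed (increments w) (Suc n)) *
    (\<kappa> (age_after b \<tau> (increments w) n + gap T n w) - C n w) *
    of_bool (C n w < b (age_after b \<tau> (increments w) n + gap T n w))"
  by (simp add: discounted_gain_def age_eq elapsed_Suc)

lemma gain_measurable:
  assumes [measurable]: "b \<in> borel_measurable borel"
  shows "gain b \<tau> n \<in> borel_measurable M"
proof -
  note [measurable] = state_measurable[OF assms]
  show ?thesis unfolding gain_eq[abs_def] by measurable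
qed

text \<open>The discount over \<open>n\<close> gaps is a product of independent factors of mean
  \<open>\<rho>\<close>.\<close>

lemma expected_discount:
  "(\<integral>\<^sup>+w. ennreal (exp (- \<gamma> * elapsed (increments w) n)) \<partial>M) = ennreal \<rho> ^ n"
proof (induction n)
  case 0
  then show ?case by (simp add: elapsed_def emeasure_space_1)
next
  case (Suc n)
  let ?d = "\<lambda>w. ennreal (exp (- \<gamma> * elapsed (increments w) n))"
  have "(\<integral>\<^sup>+w. ennreal (exp (- \<gamma> * elapsed (increments w) (Suc n))) \<partial>M)
      = (\<integral>\<^sup>+w. ?d w * ennreal (exp (- \<gamma> * gap T n w)) \<partial>M)"
    by (intro nn_integral_cong)
      (simp add: elapsed_increments_Suc ennreal_mult[symmetric] exp_add[symmetric] algebra_simps)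
  also have "\<dots> = (\<integral>\<^sup>+w. \<integral>\<^sup>+s. \<integral>\<^sup>+c. ?d w * ennreal (exp (- \<gamma> * s))
      \<partial>distr M borel (C 0) \<partial>exponential \<mu> \<partial>M)"
    by (rule nn_integral_next_auction_age[of "\<lambda>_. 0"
          "\<lambda>t a s c. ennreal (exp (- \<gamma> * t)) * ennreal (exp (- \<gamma> * s))"]) measurable
  also have "\<dots> = (\<integral>\<^sup>+w. ennreal \<rho> * ?d w \<partial>M)"
    using discount_integral_const by (simp only: mult.commute[of "?d _"])
  also have "\<dots> = ennreal \<rho> * (\<integral>\<^sup>+w. ?d w \<partial>M)"
    by (rule nn_integral_cmult) measurable
  also have "\<dots> = ennreal \<rho> ^ Suc n" using Suc by simp
  finally show ?case .
qed

lemma remaining_value_le: "remaining_value b \<tau> n \<le> ennreal \<rho> ^ n * ennreal L"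
proof -
  have "remaining_value b \<tau> n
      \<le> (\<integral>\<^sup>+w. ennreal (exp (- \<gamma> * elapsed (increments w) n)) * ennreal L \<partial>M)"
    unfolding remaining_value_def by (intro nn_integral_mono mult_left_mono V_le zero_le)
  also have "\<dots> = ennreal \<rho> ^ n * ennreal L"
    by (subst nn_integral_multc) (measurable, simp only: expected_discount)
  finally show ?thesis .
qed

text \<open>Transversality: \<open>V\<close> is bounded and \<open>\<rho> < 1\<close>, so the tail
  decays geometrically.\<close>

lemma remaining_value_tendsto_0: "remaining_value b \<tau> \<longlonglongrightarrow> 0"
proof (rule tendsto_sandwich[OF _ _ tendsto_const])
  have "(\<lambda>n. ennreal (\<rho> ^ n * L)) \<longlonglongrightarrow> ennreal (0 * L)"
    using \<mu> \<gamma> by (intro tendsto_ennrealI tendsto_mult tendsto_const LIMSEQ_realpow_zero) auto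
  moreover have "ennreal (\<rho> ^ n * L) = ennreal \<rho> ^ n * ennreal L" for n
    using \<mu> \<gamma> L_nonneg by (subst ennreal_mult) (auto simp: ennreal_power)
  ultimately show "(\<lambda>n. ennreal \<rho> ^ n * ennreal L) \<longlonglongrightarrow> 0" by simp
qed (auto intro: remaining_value_le always_eventually)

lemma remaining_value_0: "remaining_value b \<tau> 0 = V \<tau>"
  by (simp add: remaining_value_def elapsed_def emeasure_space_1)

text \<open>Expand \<open>V\<close> at the current age by the Bellman equation, then replace the
  integrals over the laws of gap and price by the actual next auction.\<close>

lemma remaining_value_next:
  assumes b: "b \<in> borel_measurable borel"
  shows "remaining_value b \<tau> n = (\<integral>\<^sup>+w. ennreal (exp (- \<gamma> * elapsed (increments w) (Suc n))) *
      continuation V (age_after b \<tau> (increments w) n + gap T n w) (C n w) \<partial>M)"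
proof -
  let ?D = "distr M borel (C 0)"
  interpret D: prob_space ?D by (rule D)
  let ?F = "\<lambda>t a s c. ennreal (exp (- \<gamma> * t)) * (ennreal (exp (- \<gamma> * s)) * continuation V (a + s) c)"
  have inner: "(\<integral>\<^sup>+s. \<integral>\<^sup>+c. ?F t a s c \<partial>?D \<partial>exponential \<mu>) = ennreal (exp (- \<gamma> * t)) * V a" for t a
  proof -
    have "(\<integral>\<^sup>+s. \<integral>\<^sup>+c. ?F t a s c \<partial>?D \<partial>exponential \<mu>)
        = (\<integral>\<^sup>+s. ennreal (exp (- \<gamma> * t)) *
            (\<integral>\<^sup>+c. ennreal (exp (- \<gamma> * s)) * continuation V (a + s) c \<partial>?D) \<partial>exponential \<mu>)"
      by (intro nn_integral_cong nn_integral_cmult) measurable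
    also have "\<dots> = ennreal (exp (- \<gamma> * t)) * bellman V a"
      unfolding bellman_def by (intro nn_integral_cmult) measurable
    finally show ?thesis by (simp add: V_unfold[symmetric])
  qed
  have "remaining_value b \<tau> n = (\<integral>\<^sup>+w. ?F (elapsed (increments w) n)
      (age_after b \<tau> (increments w) n) (gap T n w) (C n w) \<partial>M)"
    unfolding remaining_value_def inner[symmetric]
    by (rule nn_integral_next_auction_age[OF b, symmetric]) measurable
  also have "\<dots> = (\<integral>\<^sup>+w. ennreal (exp (- \<gamma> * elapsed (increments w) (Suc n))) *
      continuation V (age_after b \<tau> (increments w) n + gap T n w) (C n w) \<partial>M)"
    by (intro nn_integral_cong)
      (simp add: elapsed_increments_Suc mult.assoc[symmetric] ennreal_mult[symmetric]
        exp_add[symmetric] algebra_simps)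
  finally show ?thesis .
qed

section \<open>Telescoping of profits and losses\<close>

definition expected_profit :: "(real \<Rightarrow> real) \<Rightarrow> real \<Rightarrow> nat \<Rightarrow> ennreal" where
  "expected_profit b \<tau> n = (\<integral>\<^sup>+w. ennreal (gain b \<tau> n w) \<partial>M)"

definition expected_loss :: "(real \<Rightarrow> real) \<Rightarrow> real \<Rightarrow> nat \<Rightarrow> ennreal" where
  "expected_loss b \<tau> n = (\<integral>\<^sup>+w. ennreal (- gain b \<tau> n w) \<partial>M)"

text \<open>One step of the supermartingale, integrated from the pointwise comparison. Only sums
  occur, so infinite expected losses cause no harm.\<close>

lemma expected_step:
  assumes b [measurable]: "b \<in> borel_measurable borel"
  shows "expected_profit b \<tau> n + remaining_value b \<tau> (Suc n)
      \<le> remaining_value b \<tau> n + expected_loss b \<tau> n"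
    and "(\<And>x. b x = max 0 (\<kappa> x + v 0 - v x)) \<Longrightarrow>
      expected_profit b \<tau> n + remaining_value b \<tau> (Suc n)
      = remaining_value b \<tau> n + expected_loss b \<tau> n"
proof -
  note [measurable] = state_measurable[OF b]
  let ?e = "\<lambda>w. exp (- \<gamma> * elapsed (increments w) (Suc n))"
  let ?x = "\<lambda>w. age_after b \<tau> (increments w) n + gap T n w"
  let ?l = "\<lambda>w. ennreal (gain b \<tau> n w) + ennreal (?e w) * V (age_after b \<tau> (increments w) (Suc n))"
  let ?r = "\<lambda>w. ennreal (?e w) * continuation V (?x w) (C n w) + ennreal (- gain b \<tau> n w)"
  have gain: "(\<lambda>w. ennreal (gain b \<tau> n w)) \<in> borel_measurable M"
    "(\<lambda>w. ennreal (- gain b \<tau> n w)) \<in> borel_measurable M"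
    using gain_measurable[OF b, of \<tau> n] by auto
  have l: "expected_profit b \<tau> n + remaining_value b \<tau> (Suc n) = (\<integral>\<^sup>+w. ?l w \<partial>M)"
    unfolding expected_profit_def remaining_value_def
    by (intro nn_integral_add[symmetric] gain(1)) measurable
  have r: "remaining_value b \<tau> n + expected_loss b \<tau> n = (\<integral>\<^sup>+w. ?r w \<partial>M)"
    unfolding expected_loss_def remaining_value_next[OF b]
    by (intro nn_integral_add[symmetric] gain(2)) measurable
  have "?l w \<le> ?r w" if "w \<in> space M" for w
    using gain_plus_continuation_le(1)[OF price_nonneg[OF that, of n], of "?e w" "?x w"
        "C n w < b (?x w)"]
    by (simp only: gain_eq age_after.simps increments_simps exp_ge_zero simp_thms)
  then show "expected_profit b \<tau> n + remaining_value b \<tau> (Suc n)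
      \<le> remaining_value b \<tau> n + expected_loss b \<tau> n"
    unfolding l r by (intro nn_integral_mono)
  assume "\<And>x. b x = max 0 (\<kappa> x + v 0 - v x)"
  \<comment> \<open>As prices are nonnegative, cutting the bid off at 0 does not change which
    auctions are won.\<close>
  then have "C n w < b (?x w) \<longleftrightarrow> C n w < \<kappa> (?x w) + v 0 - v (?x w)" if "w \<in> space M" for w
    using price_nonneg[OF that, of n] by (auto simp: less_max_iff_disj)
  then have "?l w = ?r w" if "w \<in> space M" for w
    using gain_plus_continuation_le(2)[OF price_nonneg[OF that, of n], of "?e w" "C n w < b (?x w)" "?x w"] that
    by (simp only: gain_eq age_after.simps increments_simps exp_ge_zero simp_thms)
  then show "expected_profit b \<tau> n + remaining_value b \<tau> (Suc n)
      = remaining_value b \<tau> n + expected_loss b \<tau> n"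
    unfolding l r by (intro nn_integral_cong)
qed

lemma partial_sums_le:
  assumes b: "b \<in> borel_measurable borel"
  shows "(\<Sum>i<n. expected_profit b \<tau> i) + remaining_value b \<tau> n
      \<le> V \<tau> + (\<Sum>i<n. expected_loss b \<tau> i)"
proof (induction n)
  case (Suc n)
  have "(\<Sum>i<Suc n. expected_profit b \<tau> i) + remaining_value b \<tau> (Suc n)
      = (\<Sum>i<n. expected_profit b \<tau> i) + (expected_profit b \<tau> n + remaining_value b \<tau> (Suc n))"
    by (simp add: add.assoc)
  also have "\<dots> \<le> (\<Sum>i<n. expected_profit b \<tau> i) + (remaining_value b \<tau> n + expected_loss b \<tau> n)"
    by (intro add_left_mono expected_step(1) b)
  also have "\<dots> \<le> V \<tau> + (\<Sum>i<n. expected_loss b \<tau> i) + expected_loss b \<tau> n"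
    unfolding add.assoc[symmetric] by (intro add_right_mono Suc)
  finally show ?case by (simp add: add.assoc)
qed (simp add: remaining_value_0)

lemma partial_sums_eq:
  assumes b: "b \<in> borel_measurable borel" and opt: "\<And>x. b x = max 0 (\<kappa> x + v 0 - v x)"
  shows "(\<Sum>i<n. expected_profit b \<tau> i) + remaining_value b \<tau> n
      = V \<tau> + (\<Sum>i<n. expected_loss b \<tau> i)"
proof (induction n)
  case (Suc n)
  have "(\<Sum>i<Suc n. expected_profit b \<tau> i) + remaining_value b \<tau> (Suc n)
      = (\<Sum>i<n. expected_profit b \<tau> i) + (expected_profit b \<tau> n + remaining_value b \<tau> (Suc n))"
    by (simp add: add.assoc)
  also have "\<dots> = (\<Sum>i<n. expected_profit b \<tau> i) + remaining_value b \<tau> n + expected_loss b \<tau> n"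
    by (simp add: expected_step(2)[OF b opt] add.assoc)
  also have "\<dots> = V \<tau> + (\<Sum>i<n. expected_loss b \<tau> i) + expected_loss b \<tau> n"
    by (simp only: Suc)
  finally show ?case by (simp add: add.assoc)
qed (simp add: remaining_value_0)

text \<open>Auction \<open>n\<close> is discounted by \<open>n + 1\<close> gaps and gains at most
  \<open>K\<close>, giving a geometric majorant. This excludes infinity minus infinity in the policy
  value.\<close>

lemma expected_profit_finite: "(\<Sum>n. expected_profit b \<tau> n) < \<top>"
proof -
  have le: "expected_profit b \<tau> n \<le> ennreal (\<rho> ^ Suc n * K)" for n
  proof -
    have "gain b \<tau> n w \<le> exp (- \<gamma> * elapsed (increments w) (Suc n)) * K" if "w \<in> space M" for w
    proof -
      have "\<kappa> x - C n w \<le> K" for x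
        using \<kappa>_le[of x] price_nonneg[OF that, of n] by linarith
      then show ?thesis
        unfolding gain_eq mult.assoc using K_nonneg by (intro mult_left_mono) (auto simp: of_bool_def)
    qed
    then have "expected_profit b \<tau> n
        \<le> (\<integral>\<^sup>+w. ennreal (exp (- \<gamma> * elapsed (increments w) (Suc n))) * ennreal K \<partial>M)"
      unfolding expected_profit_def
      by (intro nn_integral_mono) (simp add: ennreal_mult'[symmetric] ennreal_leI)
    also have "\<dots> = ennreal \<rho> ^ Suc n * ennreal K"
      by (subst nn_integral_multc) (measurable, simp only: expected_discount)
    also have "\<dots> = ennreal (\<rho> ^ Suc n * K)"
      using \<mu> \<gamma> K_nonneg by (subst ennreal_mult) (auto simp: ennreal_power simp del: power_Suc)
    finally show ?thesis .
  qed
  have "summable (\<lambda>n. \<rho> ^ n)"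
    using \<mu> \<gamma> by (intro summable_geometric) auto
  then have "summable (\<lambda>n. \<rho> ^ Suc n * K)"
    by (intro summable_mult2) (simp add: summable_Suc_iff del: power_Suc)
  then have "(\<Sum>n. ennreal (\<rho> ^ Suc n * K)) \<noteq> \<top>"
    using \<mu> \<gamma> K_nonneg by (intro ennreal_suminf_neq_top) auto
  moreover have "(\<Sum>n. expected_profit b \<tau> n) \<le> (\<Sum>n. ennreal (\<rho> ^ Suc n * K))"
    by (intro suminf_le le summableI)
  ultimately show ?thesis by (simp add: less_top top_unique)
qed

lemma policy_value_eq:
  assumes b: "b \<in> borel_measurable borel"
  shows "policy_value M T C \<gamma> \<kappa> b \<tau>
    = enn2ereal (\<Sum>n. expected_profit b \<tau> n) - enn2ereal (\<Sum>n. expected_loss b \<tau> n)"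
proof -
  note [measurable] = gain_measurable[OF b]
  show ?thesis
    unfolding policy_value_def expected_profit_def expected_loss_def
    by (subst (1 2) nn_integral_suminf) auto
qed

lemma policy_value_le:
  assumes b: "b \<in> borel_measurable borel"
  shows "policy_value M T C \<gamma> \<kappa> b \<tau> \<le> ereal (v \<tau>)"
proof -
  let ?P = "\<Sum>n. expected_profit b \<tau> n" and ?N = "\<Sum>n. expected_loss b \<tau> n"
  have "?P \<le> V \<tau> + ?N"
  proof (rule suminf_le_const[OF summableI])
    fix n
    have "(\<Sum>i<n. expected_profit b \<tau> i) \<le> (\<Sum>i<n. expected_profit b \<tau> i) + remaining_value b \<tau> n"
      by simp
    also have "\<dots> \<le> V \<tau> + (\<Sum>i<n. expected_loss b \<tau> i)" by (rule partial_sums_le[OF b])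
    also have "\<dots> \<le> V \<tau> + ?N" by (intro add_left_mono sum_le_suminf) auto
    finally show "(\<Sum>i<n. expected_profit b \<tau> i) \<le> V \<tau> + ?N" .
  qed
  then show ?thesis
    unfolding policy_value_eq[OF b] V_eq using expected_profit_finite[of b \<tau>] v_nonneg[of \<tau>]
    by (cases ?P; cases ?N) (auto simp flip: ennreal_plus simp: enn2ereal_ennreal)
qed

lemma policy_value_attained:
  assumes b: "b \<in> borel_measurable borel" and opt: "\<And>x. b x = max 0 (\<kappa> x + v 0 - v x)"
  shows "policy_value M T C \<gamma> \<kappa> b \<tau> = ereal (v \<tau>)"
proof (rule antisym[OF policy_value_le[OF b]])
  let ?P = "\<Sum>n. expected_profit b \<tau> n" and ?N = "\<Sum>n. expected_loss b \<tau> n"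
  \<comment> \<open>The 0 is the limit of the remaining value. Since \<open>?P\<close> is finite,
    this also forces the losses of the optimal policy to be finite.\<close>
  have "V \<tau> + ?N \<le> ?P + 0"
  proof (rule LIMSEQ_le)
    show "(\<lambda>n. V \<tau> + (\<Sum>i<n. expected_loss b \<tau> i)) \<longlonglongrightarrow> V \<tau> + ?N"
      by (intro tendsto_add tendsto_const summable_LIMSEQ summableI)
    show "(\<lambda>n. (\<Sum>i<n. expected_profit b \<tau> i) + remaining_value b \<tau> n) \<longlonglongrightarrow> ?P + 0"
      by (intro tendsto_add remaining_value_tendsto_0 summable_LIMSEQ summableI)
  qed (simp add: partial_sums_eq[OF b opt])
  then show "ereal (v \<tau>) \<le> policy_value M T C \<gamma> \<kappa> b \<tau>"
    unfolding policy_value_eq[OF b] V_eq using expected_profit_finite[of b \<tau>] v_nonneg[of \<tau>]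
    by (cases ?P; cases ?N) (auto simp flip: ennreal_plus simp: enn2ereal_ennreal top_unique)
qed

section \<open>The optimal value and the optimal bid\<close>

lemma optimal_value_eq:
  assumes k: "\<And>x. 0 \<le> x \<Longrightarrow> k x = \<kappa> x" and \<tau>: "0 \<le> \<tau>"
  shows "optimal_value M T C \<gamma> k \<tau> = v \<tau>"
proof -
  let ?b = "\<lambda>x. max 0 (\<kappa> x + v 0 - v x)"
  have b: "?b \<in> borel_measurable borel" by measurable
  have "(SUP b\<in>policies. policy_value M T C \<gamma> k b \<tau>) = ereal (v \<tau>)"
  proof (rule antisym[OF SUP_least])
    fix b assume "b \<in> policies"
    \<comment> \<open>A policy is measurable on \<open>{0..}\<close> only; its extension agrees with
      it at every age that occurs.\<close>
    then have "(\<lambda>x. b (max 0 x)) \<in> borel_measurable borel"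
      by (auto simp: policies_def intro: measurable_compose[OF max_0_measurable])
    from policy_value_le[OF this] show "policy_value M T C \<gamma> k b \<tau> \<le> ereal (v \<tau>)"
      using policy_value_nonneg_ages[OF \<tau>, of b "\<lambda>x. b (max 0 x)" k \<kappa>] k by simp
  next
    have "?b \<in> policies"
      using measurable_restrict_space1[OF b] by (simp add: policies_def)
    moreover have "policy_value M T C \<gamma> k ?b \<tau> = ereal (v \<tau>)"
      using policy_value_nonneg_ages[OF \<tau>, of ?b ?b k \<kappa>] k policy_value_attained[OF b] by simp
    ultimately show "ereal (v \<tau>) \<le> (SUP b\<in>policies. policy_value M T C \<gamma> k b \<tau>)"
      by (intro SUP_upper2[of ?b]) simp_all
  qed
  then show ?thesis by (simp add: optimal_value_def)
qed

text \<open>The truncation at 0 never acts: \<open>v\<close> rises from age 0 by no more than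
  \<open>\<kappa>\<close> does, so the untruncated bid is at least
  \<open>\<kappa> 0 \<ge> 0\<close>.\<close>

lemma optimal_bid_eq:
  assumes k: "\<And>x. 0 \<le> x \<Longrightarrow> k x = \<kappa> x" and \<tau>: "0 \<le> \<tau>"
  shows "optimal_bid M T C \<gamma> k \<tau> = \<kappa> \<tau> + v 0 - v \<tau>"
proof -
  have "v \<tau> - v 0 \<le> \<rho> * (\<kappa> \<tau> - \<kappa> 0)" using \<tau> by (intro v_increment) auto
  also have "\<dots> \<le> \<kappa> \<tau> - \<kappa> 0"
    using \<mu> \<gamma> monoD[OF \<kappa>_mono \<tau>] by (intro mult_left_le_one_le) auto
  finally show ?thesis
    using \<kappa>_nonneg[of 0] \<tau> k by (simp add: optimal_bid_def optimal_value_eq)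
qed

text \<open>Since \<open>v\<close> absorbs at most the fraction \<open>\<rho>\<close> of an
  increment of \<open>k\<close>, the bid keeps at least \<open>1 - \<rho> > 0\<close> of it; both
  monotonicity claims follow.\<close>

lemma optimal_bid_increment:
  assumes k: "\<And>x. 0 \<le> x \<Longrightarrow> k x = \<kappa> x" and "0 \<le> x" "x \<le> y"
  shows "(1 - \<rho>) * (k y - k x) \<le> optimal_bid M T C \<gamma> k y - optimal_bid M T C \<gamma> k x"
  using v_increment[OF assms(2,3)] assms by (simp add: optimal_bid_eq[OF k] algebra_simps)

end

theorem theorem1:
  fixes M :: "'w measure" and \<mu> \<gamma> :: real
    and T C :: "nat \<Rightarrow> 'w \<Rightarrow> real" and q k :: "real \<Rightarrow> real"
  assumes "auctions M \<mu> T C q"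
    and "\<mu> > 0" and "\<gamma> > 0"
    and "\<And>\<tau>. \<tau> \<ge> 0 \<Longrightarrow> k \<tau> \<ge> 0"
    and "bounded (k ` {0..})"
    and "mono_on {0..} k"
    and "concave_on {0..} k"
  shows "mono_on {0..} (optimal_bid M T C \<gamma> k) \<and>
    (\<forall>I. is_interval I \<longrightarrow> I \<subseteq> {0..} \<longrightarrow> strict_mono_on I k \<longrightarrow>
       strict_mono_on I (optimal_bid M T C \<gamma> k))"
proof -
  interpret auctions M \<mu> T C q by fact
  obtain K where K: "\<And>x. 0 \<le> x \<Longrightarrow> \<bar>k x\<bar> \<le> K"
    using assms(5) by (auto simp: bounded_iff)
  define \<kappa> where "\<kappa> x = k (max 0 x)" for x
  have \<kappa>: "k x = \<kappa> x" if "0 \<le> x" for x using that by (simp add: \<kappa>_def)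
  interpret auction_problem M \<mu> \<gamma> K T C q \<kappa>
  proof (intro auction_problem.intro dynamic_value.intro)
    show "prob_space (distr M borel (C 0))" by (rule prob_space_distr) simp
    show "mono \<kappa>"
      by (auto simp: \<kappa>_def mono_def intro!: mono_onD[OF assms(6)])
    show "concave_on {0..} \<kappa>"
      using assms(7) by (simp add: concave_on_iff \<kappa>_def)
    show "\<kappa> x \<le> K" for x using K[of "max 0 x"] by (simp add: \<kappa>_def)
  qed (use assms in \<open>auto simp: \<kappa>_def\<close>)
  have increment: "(1 - \<rho>) * (k y - k x) \<le> optimal_bid M T C \<gamma> k y - optimal_bid M T C \<gamma> k x"
    if "0 \<le> x" "x \<le> y" for x y
    using optimal_bid_increment[of k x y] \<kappa> that by blast
  have pos: "0 < 1 - \<rho>" using assms(2,3) by simp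
  show ?thesis
  proof (intro conjI allI impI monotone_onI)
    fix x y :: real assume xy: "x \<in> {0..}" "y \<in> {0..}" "x \<le> y"
    have "0 \<le> (1 - \<rho>) * (k y - k x)"
      using pos mono_onD[OF assms(6) xy] by simp
    also have "\<dots> \<le> optimal_bid M T C \<gamma> k y - optimal_bid M T C \<gamma> k x"
      using xy by (intro increment) auto
    finally show "optimal_bid M T C \<gamma> k x \<le> optimal_bid M T C \<gamma> k y" by simp
  next
    fix I x y assume I: "I \<subseteq> {0..}" "strict_mono_on I k" and xy: "x \<in> I" "y \<in> I" "x < y"
    have "0 < (1 - \<rho>) * (k y - k x)"
      using pos strict_mono_onD[OF I(2) xy] by simp
    also have "\<dots> \<le> optimal_bid M T C \<gamma> k y - optimal_bid M T C \<gamma> k x"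
      using I xy by (intro increment) auto
    finally show "optimal_bid M T C \<gamma> k x < optimal_bid M T C \<gamma> k y" by simp
  qed
qed

end
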